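(* For every integer $k \ge 3$, we have $$\frac{k!}{2}+1 \le f_{\mathrm{wES}}(k) \le \binom{(k-1)^2+1}{k} - \binom{(k-1)^2 - 1}{k-1},$$ where $f_{\mathrm{wES}}(k)$ denotes the minimum number of edges in a $k$-graph with the weak Erdős–Szekeres Property.
   Context: A $k$-graph ($k$-uniform hypergraph) is a pair $\mathcal{H} = (V,\mathcal{E})$ where $V$ is a finite vertex set and $\mathcal{E}$ is a family of $k$-element subsets of $V$. Two linear orders $<_1$ and $<_2$ on $V$ are monotonically consistent on an edge $e \in \mathcal{E}$ if the order induced by $<_2$ on $e$ is either equal to the order induced by $<_1$ on $e$ or is its reverse. A $k$-graph $\mathcal{H} = (V,\mathcal{E})$ has the weak Erdős–Szekeres Property if there exists a linear order $<_1$ on $V$ such that, for every linear order $<_2$ on $V$, there exists an edge $e \in \mathcal{E}$ on which $<_1$ and $<_2$ are monotonically consistent. Define $$f_{\mathrm{wES}}(k) := \min\{|\mathcal{E}| : \text{there exists a } k\text{-graph } \mathcal{H}=(V,\mathcal{E}) \text{ with the weak Erdős–Szekeres Property}\}.$$ *)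

theory Defs
  imports Complex_Main
begin

definition kgraph :: "nat \<Rightarrow> 'a set \<Rightarrow> 'a set set \<Rightarrow> bool" where
  "kgraph k V E \<longleftrightarrow> finite V \<and> (\<forall>e\<in>E. e \<subseteq> V \<and> card e = k)"

(* Linear orders are reflexive relations in the sense of linear_order_on. *)
definition monotonically_consistent :: "'a rel \<Rightarrow> 'a rel \<Rightarrow> 'a set \<Rightarrow> bool" where
  "monotonically_consistent r s e \<longleftrightarrow> Restr s e = Restr r e \<or> Restr s e = (Restr r e)\<inverse>"

definition weak_ES :: "'a set \<Rightarrow> 'a set set \<Rightarrow> bool" where
  "weak_ES V E \<longleftrightarrow>
     (\<exists>r. linear_order_on V r \<and>
        (\<forall>s. linear_order_on V s \<longrightarrow> (\<exists>e\<in>E. monotonically_consistent r s e)))"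

(* Vertices are natural numbers; this is no restriction, see f_wES_le below. *)
definition f_wES :: "nat \<Rightarrow> nat" where
  "f_wES k = (LEAST m. \<exists>(V :: nat set) E. kgraph k V E \<and> weak_ES V E \<and> card E = m)"

lemma linear_order_on_inv_image:
  assumes "inj_on f V" and "linear_order_on (f ` V) s"
  shows "linear_order_on V {(x, y). x \<in> V \<and> y \<in> V \<and> (f x, f y) \<in> s}"
proof -
  let ?t = "{(x, y). x \<in> V \<and> y \<in> V \<and> (f x, f y) \<in> s}"
  have s: "refl_on (f ` V) s" "trans s" "antisym s" "total_on (f ` V) s"
    using assms(2) by (auto simp: order_on_defs)
  have "refl_on V ?t"
    using s(1) by (simp add: refl_on_def)
  moreover have "trans ?t"
    using s(2) by (auto intro!: transI dest: transD)
  moreover have "antisym ?t"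
    using s(3) assms(1) by (auto intro!: antisymI dest!: antisymD dest: inj_onD)
  moreover have "total_on V ?t"
    using s(4) assms(1) by (auto simp: total_on_def inj_on_eq_iff)
  ultimately show ?thesis
    by (auto simp: order_on_defs)
qed

lemma weak_ES_image:
  fixes f :: "'a \<Rightarrow> 'b"
  assumes inj: "inj_on f V" and sub: "\<forall>e\<in>E. e \<subseteq> V" and wES: "weak_ES V E"
  shows "weak_ES (f ` V) ((`) f ` E)"
proof -
  obtain r where r: "linear_order_on V r"
    and cons: "\<And>s. linear_order_on V s \<Longrightarrow> \<exists>e\<in>E. monotonically_consistent r s e"
    using wES unfolding weak_ES_def by blast
  define g where "g = inv_into V f"
  define r' where "r' = {(x, y). x \<in> f ` V \<and> y \<in> f ` V \<and> (g x, g y) \<in> r}"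
  have gf: "g (f x) = x" if "x \<in> V" for x
    using that inj by (simp add: g_def)
  have "inj_on g (f ` V)" "g ` f ` V = V"
    using gf by (auto simp: inj_on_def image_iff)
  then have r': "linear_order_on (f ` V) r'"
    unfolding r'_def using r by (intro linear_order_on_inv_image) auto
  have "\<exists>e\<in>(`) f ` E. monotonically_consistent r' s e" if s: "linear_order_on (f ` V) s" for s
  proof -
    define t where "t = {(x, y). x \<in> V \<and> y \<in> V \<and> (f x, f y) \<in> s}"
    have "linear_order_on V t"
      unfolding t_def using inj s by (rule linear_order_on_inv_image)
    then obtain e where e: "e \<in> E" "monotonically_consistent r t e"
      using cons by blast
    have eV: "e \<subseteq> V" using sub e(1) by blast
    have img: "Restr R (f ` e) = map_prod f f ` Restr P e"
      if "\<And>x y. x \<in> e \<Longrightarrow> y \<in> e \<Longrightarrow> (f x, f y) \<in> R \<longleftrightarrow> (x, y) \<in> P" for R P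
      using that by (auto intro: map_prod_imageI)
    have "(f x, f y) \<in> r' \<longleftrightarrow> (x, y) \<in> r" if "x \<in> e" "y \<in> e" for x y
      using that eV gf unfolding r'_def by (simp add: subset_iff)
    then have "Restr r' (f ` e) = map_prod f f ` Restr r e"
      by (rule img)
    moreover have "(f x, f y) \<in> s \<longleftrightarrow> (x, y) \<in> t" if "x \<in> e" "y \<in> e" for x y
      using that eV unfolding t_def by (simp add: subset_iff)
    then have "Restr s (f ` e) = map_prod f f ` Restr t e"
      by (rule img)
    moreover have "map_prod f f ` (Restr r e)\<inverse> = (map_prod f f ` Restr r e)\<inverse>"
      by force
    ultimately have "monotonically_consistent r' s (f ` e)"
      using e(2) unfolding monotonically_consistent_def by metis
    then show ?thesis using e(1) by blast
  qed
  then show ?thesis using r' unfolding weak_ES_def by blast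
qed

lemma f_wES_le:
  fixes V :: "'a set"
  assumes "kgraph k V E" and "weak_ES V E"
  shows "f_wES k \<le> card E"
proof -
  have fin: "finite V" and E: "\<forall>e\<in>E. e \<subseteq> V \<and> card e = k"
    using assms(1) by (auto simp: kgraph_def)
  obtain f :: "'a \<Rightarrow> nat" where inj: "inj_on f V"
    using finite_imp_inj_to_nat_seg[OF fin] by blast
  have "weak_ES (f ` V) ((`) f ` E)"
    using weak_ES_image[OF inj _ assms(2)] E by blast
  moreover have "kgraph k (f ` V) ((`) f ` E)"
    using fin E inj unfolding kgraph_def
    by (auto simp: card_image inj_on_subset)
  moreover have "card ((`) f ` E) = card E"
    using E inj by (intro card_image inj_on_subset[OF inj_on_image_Pow[OF inj]]) auto
  ultimately show ?thesis
    unfolding f_wES_def by (intro Least_le) blast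
qed

end

theory Submission
  imports Defs "HOL-Combinatorics.Permutations"
begin

text \<open>
  Lower bound: on a fixed edge a uniformly random order induces each of the \<open>k!\<close> orders equally
  often, so an edge is consistent with at most a fraction \<open>2 / k!\<close> of all orders on \<open>V\<close>. The
  order \<open><\<^sub>1\<close> itself is consistent with every edge, so the union bound is strict, and
  \<open>k!\<close> is even.

  Upper bound: put \<open>m = k - 1\<close>, take the vertices \<open>0, \<dots>, m\<^sup>2\<close> in their natural order and all
  \<open>k\<close>-sets that contain \<open>1\<close> whenever they contain \<open>0\<close>. Label \<open>i \<ge> 1\<close> by the greatest
  lengths of an increasing and of a decreasing sequence starting at \<open>i\<close>. If there is no monotone
  sequence of length \<open>k\<close> among \<open>1, \<dots>, m\<^sup>2\<close>, the labels are exactly the pairs in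
  \<open>{1..m} \<times> {1..m}\<close>, and only \<open>1\<close> can carry \<open>(m, m)\<close>. Whichever way \<open>0\<close> and \<open>1\<close> compare, \<open>0\<close>
  therefore extends a monotone sequence of length \<open>m\<close> starting at \<open>1\<close>.
\<close>

section \<open>Lower bound\<close>

text \<open>In a finite linear order an element is determined by the number of elements below it.
  The hypothesis gives \<open>p x\<close> and \<open>q x\<close> equal such numbers, since permuting
  \<open>A\<close> does not change the count.\<close>

lemma linear_order_automorphism_unique:
  assumes "finite A" "antisym r" "trans r" and tot: "total_on A r" and rf: "refl_on A r"
    and p: "p permutes A" and q: "q permutes A"
    and eq: "\<And>x y. x \<in> A \<Longrightarrow> y \<in> A \<Longrightarrow> (p x, p y) \<in> r \<longleftrightarrow> (q x, q y) \<in> r"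
  shows "p = q"
proof
  fix x
  define rk where "rk z = {y \<in> A. (y, z) \<in> r}" for z
  have card_rk: "card (rk (f x)) = card {y \<in> A. (f y, f x) \<in> r}" if f: "f permutes A" for f
  proof -
    have "rk (f x) = f ` {y \<in> A. (f y, f x) \<in> r}"
      using permutes_image[OF f] unfolding rk_def by (auto simp: image_iff)
    then show ?thesis
      using card_image[OF permutes_inj_on[OF f]] by metis
  qed
  show "p x = q x"
  proof (cases "x \<in> A")
    case True
    have "{y \<in> A. (p y, p x) \<in> r} = {y \<in> A. (q y, q x) \<in> r}"
      using eq True by blast
    then have same: "card (rk (p x)) = card (rk (q x))"
      by (simp add: card_rk p q)
    have less: "card (rk a) < card (rk b)" if "a \<in> A" "b \<in> A" "(a, b) \<in> r" "a \<noteq> b" for a b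
    proof (rule psubset_card_mono)
      show "finite (rk b)" using \<open>finite A\<close> by (simp add: rk_def)
      have "b \<in> rk b" using rf that by (auto simp: rk_def refl_on_def)
      moreover have "b \<notin> rk a" using that \<open>antisym r\<close> by (auto simp: rk_def dest: antisymD)
      moreover have "rk a \<subseteq> rk b" using that \<open>trans r\<close> by (auto simp: rk_def dest: transD)
      ultimately show "rk a \<subset> rk b" by blast
    qed
    have "p x \<in> A" "q x \<in> A"
      using True p q by (simp_all add: permutes_in_image)
    then show ?thesis
      using less same tot unfolding total_on_def by (metis less_irrefl)
  next
    case False
    then show ?thesis using p q by (simp add: permutes_not_in)
  qed
qed

lemma finite_linear_orders:
  assumes "finite V"
  shows "finite {s. linear_order_on V s}"
  by (rule finite_subset[of _ "Pow (V \<times> V)"])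
    (use assms in \<open>auto simp: order_on_defs\<close>)

text \<open>Permutations of \<open>e\<close> act on the orders of \<open>V\<close> by pullback
  (\<open>act\<close>). On pairs of a permutation and an order extending that of \<open>r\<close> on
  \<open>e\<close>, this is injective: the pulled-back order on \<open>e\<close> reveals the
  permutation, and undoing it recovers the order.\<close>

lemma fact_mult_card_extensions_le:
  assumes V: "finite V" and e: "e \<subseteq> V" and r: "linear_order_on V r"
  shows "fact (card e) * card {s. linear_order_on V s \<and> Restr s e = Restr r e}
    \<le> card {s. linear_order_on V s}"
proof -
  let ?S = "{s. linear_order_on V s \<and> Restr s e = Restr r e}"
  let ?P = "{p. p permutes e}"
  define act where "act = (\<lambda>(p, s). {(x, y). x \<in> V \<and> y \<in> V \<and> ((p :: 'a \<Rightarrow> 'a) x, p y) \<in> s})"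
  have fe: "finite e" using V e by (rule finite_subset[rotated])
  have "inj_on act (?P \<times> ?S)"
  proof (rule inj_onI, clarify)
    fix p s q t
    assume p: "p permutes e" and q: "q permutes e"
      and s: "linear_order_on V s" "Restr s e = Restr r e"
      and t: "linear_order_on V t" "Restr t e = Restr r e"
      and eq: "act (p, s) = act (q, t)"
    have iff: "(p x, p y) \<in> s \<longleftrightarrow> (q x, q y) \<in> t" if "x \<in> V" "y \<in> V" for x y
      using eq that unfolding act_def by (auto simp: set_eq_iff)
    have rs: "(x, y) \<in> s \<longleftrightarrow> (x, y) \<in> r" "(x, y) \<in> t \<longleftrightarrow> (x, y) \<in> r"
      if "x \<in> e" "y \<in> e" for x y
      using that s(2) t(2) by blast+
    \<comment> \<open>On \<open>e\<close> both \<open>s\<close> and \<open>t\<close> coincide with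
      \<open>r\<close>, so \<open>p\<close> and \<open>q\<close> pull the same order on
      \<open>e\<close> back to the same relation.\<close>
    have pq: "p = q"
    proof (rule linear_order_automorphism_unique[OF fe _ _ _ _ p q, of r])
      show "antisym r" "trans r" using r by (auto simp: order_on_defs)
      show "total_on e r" "refl_on e r"
        using r e unfolding order_on_defs refl_on_def by (blast intro: total_on_subset)+
      show "(p x, p y) \<in> r \<longleftrightarrow> (q x, q y) \<in> r" if "x \<in> e" "y \<in> e" for x y
        using iff[of x y] rs that e p q by (auto simp: permutes_in_image subset_iff)
    qed
    have pV: "p ` V = V" using permutes_image[OF permutes_subset[OF p e]] .
    have sub: "s \<subseteq> V \<times> V" "t \<subseteq> V \<times> V" using s t by (auto simp: order_on_defs)
    have st: "(a, b) \<in> s \<longleftrightarrow> (a, b) \<in> t" if ab: "a \<in> V" "b \<in> V" for a b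
    proof -
      obtain x where x: "x \<in> V" "a = p x" using ab(1) pV by (metis imageE)
      obtain y where y: "y \<in> V" "b = p y" using ab(2) pV by (metis imageE)
      show ?thesis using iff[OF x(1) y(1)] x(2) y(2) pq by simp
    qed
    have "s = t"
    proof (intro subset_antisym subrelI)
      show "(a, b) \<in> t" if "(a, b) \<in> s" for a b
        using that st[of a b] subsetD[OF sub(1) that] by simp
      show "(a, b) \<in> s" if "(a, b) \<in> t" for a b
        using that st[of a b] subsetD[OF sub(2) that] by simp
    qed
    with pq show "p = q \<and> s = t" by (rule conjI)
  qed
  moreover have "act ` (?P \<times> ?S) \<subseteq> {s. linear_order_on V s}"
  proof clarify
    fix p s assume p: "p permutes e" and s: "linear_order_on V s"
    have "p permutes V" using p e by (rule permutes_subset)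
    then show "linear_order_on V (act (p, s))"
      unfolding act_def using linear_order_on_inv_image[of p V s] s
      by (simp add: permutes_inj_on permutes_image)
  qed
  ultimately have "card (?P \<times> ?S) \<le> card {s. linear_order_on V s}"
    by (rule card_inj_on_le[OF _ _ finite_linear_orders[OF V]])
  then show ?thesis
    by (simp add: card_cartesian_product card_permutations[OF refl fe])
qed

text \<open>Being consistent means extending either \<open>r\<close> or its converse on
  \<open>e\<close>; the factor 2 counts these two cases.\<close>

lemma fact_mult_card_consistent_le:
  assumes V: "finite V" and e: "e \<subseteq> V" and r: "linear_order_on V r"
  shows "fact (card e) * card {s. linear_order_on V s \<and> monotonically_consistent r s e}
    \<le> 2 * card {s. linear_order_on V s}"
proof -
  let ?S = "\<lambda>r. {s. linear_order_on V s \<and> Restr s e = Restr r e}"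
  have "(Restr r e)\<inverse> = Restr (r\<inverse>) e"
    by (simp only: converse_Int converse_Times)
  then have "{s. linear_order_on V s \<and> monotonically_consistent r s e} = ?S r \<union> ?S (r\<inverse>)"
    by (simp only: monotonically_consistent_def conj_disj_distribL Collect_disj_eq)
  then have "card {s. linear_order_on V s \<and> monotonically_consistent r s e}
      \<le> card (?S r) + card (?S (r\<inverse>))"
    by (simp only: card_Un_le)
  from mult_le_mono2[OF this, of "fact (card e)"] have "fact (card e) * card {s. linear_order_on V s \<and> monotonically_consistent r s e}
      \<le> fact (card e) * card (?S r) + fact (card e) * card (?S (r\<inverse>))"
    by (simp only: distrib_left)
  also have "\<dots> \<le> 2 * card {s. linear_order_on V s}"
    using fact_mult_card_extensions_le[OF V e r]
      fact_mult_card_extensions_le[OF V e, of "r\<inverse>"] r by simp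
  finally show ?thesis .
qed

lemma fact_less_twice_card_edges:
  assumes k: "k \<ge> 3" and kg: "kgraph k V E" and wES: "weak_ES V E"
  shows "fact k < 2 * card E"
proof -
  obtain r where r: "linear_order_on V r"
    and cons: "\<And>s. linear_order_on V s \<Longrightarrow> \<exists>e\<in>E. monotonically_consistent r s e"
    using wES unfolding weak_ES_def by blast
  have V: "finite V" and E: "\<And>e. e \<in> E \<Longrightarrow> e \<subseteq> V \<and> card e = k"
    using kg by (auto simp: kgraph_def)
  have fE: "finite E" by (rule finite_subset[of _ "Pow V"]) (use V E in auto)
  define L where "L = {s. linear_order_on V s}"
  define C where "C e = {s. linear_order_on V s \<and> monotonically_consistent r s e}" for e
  have fL: "finite L" unfolding L_def using V by (rule finite_linear_orders)
  have rL: "r \<in> L" and rC: "r \<in> C e" for e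
    using r by (auto simp: L_def C_def monotonically_consistent_def)
  have fC: "finite (C e)" for e
    by (rule finite_subset[OF _ fL]) (auto simp: C_def L_def)
  have pos: "card L > 0" using fL rL card_gt_0_iff by blast
  \<comment> \<open>Since \<open>r\<close> lies in every \<open>C e\<close> but counts once in
    \<open>L\<close>, deleting it before the union bound gains \<open>card E - 1\<close>.\<close>
  have "L - {r} \<subseteq> (\<Union>e\<in>E. C e - {r})"
    using cons by (auto simp: L_def C_def)
  then have "card (L - {r}) \<le> card (\<Union>e\<in>E. C e - {r})"
    using fE fC by (intro card_mono) auto
  also have "\<dots> \<le> (\<Sum>e\<in>E. card (C e - {r}))"
    using fE by (rule card_UN_le)
  finally have "card (L - {r}) + card E \<le> (\<Sum>e\<in>E. card (C e - {r}) + 1)"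
    by (simp add: sum.distrib del: Suc_eq_plus1 One_nat_def)
  also have "\<dots> = (\<Sum>e\<in>E. card (C e))"
    using card_Suc_Diff1[OF fC rC] by simp
  finally have 1: "card L + card E \<le> (\<Sum>e\<in>E. card (C e)) + 1"
    using card_Suc_Diff1[OF fL rL] by linarith
  have "fact k * (\<Sum>e\<in>E. card (C e)) = (\<Sum>e\<in>E. fact (card e) * card (C e))"
    using E by (simp add: sum_distrib_left)
  also have "\<dots> \<le> (\<Sum>e\<in>E. 2 * card L)"
    unfolding C_def L_def using E by (intro sum_mono fact_mult_card_consistent_le[OF V _ r]) auto
  finally have 2: "fact k * (\<Sum>e\<in>E. card (C e)) \<le> 2 * card E * card L"
    by simp
  have E0: "card E \<noteq> 0"
    using cons[OF r] fE by auto
  \<comment> \<open>The bound is used twice: the weak form gives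
    \<open>fact k \<le> 2 * card E\<close>, hence at least two edges because
    \<open>k \<ge> 3\<close>, and with two edges the gain from \<open>r\<close> makes it
    strict.\<close>
  have "fact k * card L \<le> fact k * (\<Sum>e\<in>E. card (C e))"
    using 1 E0 by (intro mult_le_mono2) linarith
  then have "fact k * card L \<le> 2 * card E * card L"
    using 2 by (rule order_trans)
  then have "fact k \<le> 2 * card E"
    using pos by simp
  moreover have "fact 3 \<le> (fact k :: nat)"
    using k by (rule fact_mono)
  ultimately have "card E \<ge> 2"
    by (simp add: fact_numeral)
  then have "card L < (\<Sum>e\<in>E. card (C e))"
    using 1 by linarith
  then have "fact k * card L < fact k * (\<Sum>e\<in>E. card (C e))"
    by simp
  then have "fact k * card L < 2 * card E * card L"
    using 2 by (rule less_le_trans)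
  then show ?thesis by simp
qed

section \<open>Upper bound\<close>

text \<open>Increasing sequences are kept as sets, their order being that of the natural numbers.
  Decreasing ones are obtained by passing the converse of \<open>s\<close>.\<close>

definition chains_from :: "nat set \<Rightarrow> nat rel \<Rightarrow> nat \<Rightarrow> nat set set" where
  "chains_from W s i =
     {A. A \<subseteq> W \<and> i \<in> A \<and> (\<forall>x\<in>A. i \<le> x) \<and> (\<forall>x\<in>A. \<forall>y\<in>A. x \<le> y \<longrightarrow> (x, y) \<in> s)}"

definition chain_length :: "nat set \<Rightarrow> nat rel \<Rightarrow> nat \<Rightarrow> nat" where
  "chain_length W s i = Max (card ` chains_from W s i)"

lemma finite_chains_from: "finite W \<Longrightarrow> finite (chains_from W s i)"
  by (rule finite_subset[of _ "Pow W"]) (auto simp: chains_from_def)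

lemma singleton_in_chains_from: "i \<in> W \<Longrightarrow> (i, i) \<in> s \<Longrightarrow> {i} \<in> chains_from W s i"
  by (simp add: chains_from_def)

lemma card_le_chain_length:
  "finite W \<Longrightarrow> A \<in> chains_from W s i \<Longrightarrow> card A \<le> chain_length W s i"
  unfolding chain_length_def by (intro Max_ge finite_imageI finite_chains_from imageI)

lemma longest_chain_from:
  assumes "finite W" "i \<in> W" "(i, i) \<in> s"
  obtains A where "A \<in> chains_from W s i" "card A = chain_length W s i"
proof -
  have "chain_length W s i \<in> card ` chains_from W s i"
    unfolding chain_length_def
    using assms singleton_in_chains_from by (intro Max_in finite_imageI finite_chains_from) auto
  then show thesis using that by auto
qed

text \<open>The ground set grows to \<open>insert i W\<close> so that the lemma serves both for
  \<open>i\<close> inside \<open>W\<close> and for prepending the outside vertex 0.\<close>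

lemma insert_in_chains_from:
  assumes A: "A \<in> chains_from W s j" and "i < j" "(i, i) \<in> s" "(i, j) \<in> s" "trans s"
  shows "insert i A \<in> chains_from (insert i W) s i"
proof -
  have "(i, y) \<in> s" if "y \<in> A" for y
  proof -
    have "(j, y) \<in> s" using A that by (simp add: chains_from_def)
    then show ?thesis using \<open>trans s\<close> \<open>(i, j) \<in> s\<close> by (blast dest: transD)
  qed
  then show ?thesis
    using assms by (auto simp: chains_from_def)
qed

text \<open>A longest chain from \<open>j\<close> can be prolonged by \<open>i\<close>. This is what
  makes the Erdos-Szekeres labels distinct.\<close>

lemma chain_length_less:
  assumes W: "finite W" and ij: "i \<in> W" "j \<in> W" "i < j" and s: "(i, j) \<in> s" "trans s"
    and rf: "\<And>x. x \<in> W \<Longrightarrow> (x, x) \<in> s"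
  shows "chain_length W s j < chain_length W s i"
proof -
  obtain A where A: "A \<in> chains_from W s j" "card A = chain_length W s j"
    using longest_chain_from[OF W ij(2) rf[OF ij(2)]] .
  have "insert i A \<in> chains_from W s i"
    using insert_in_chains_from[OF A(1) ij(3) rf s] ij by (simp add: insert_absorb)
  then have "card (insert i A) \<le> chain_length W s i"
    using W by (rule card_le_chain_length[rotated])
  moreover have "i \<notin> A" "finite A"
    using A(1) ij W by (auto simp: chains_from_def intro: finite_subset)
  ultimately show ?thesis using A(2) by simp
qed

abbreviation nat_order_on :: "nat set \<Rightarrow> nat rel" where
  "nat_order_on V \<equiv> {(x, y). x \<in> V \<and> y \<in> V \<and> x \<le> y}"

lemma linear_order_on_nat_order_on: "linear_order_on V (nat_order_on V)"
  by (auto simp: order_on_defs refl_on_def trans_def antisym_def total_on_def)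

lemma monotonically_consistent_converse:
  "monotonically_consistent r (s\<inverse>) e \<longleftrightarrow> monotonically_consistent r s e"
  unfolding monotonically_consistent_def by auto

text \<open>Antisymmetry turns the one-sided condition on \<open>A\<close> into equality of the two
  orders on \<open>e\<close>.\<close>

lemma chain_consistent:
  assumes s: "linear_order_on V s" and "e \<subseteq> A" "A \<subseteq> V"
    and "\<And>x y. x \<in> A \<Longrightarrow> y \<in> A \<Longrightarrow> x \<le> y \<Longrightarrow> (x, y) \<in> s"
  shows "monotonically_consistent (nat_order_on V) s e"
proof -
  have "antisym s" using s by (auto simp: order_on_defs)
  then have "(x, y) \<in> s \<longleftrightarrow> x \<le> y" if "x \<in> e" "y \<in> e" for x y
    using assms that by (metis antisymD le_cases subset_iff)
  then have "Restr s e = Restr (nat_order_on V) e"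
    using assms by auto
  then show ?thesis by (simp add: monotonically_consistent_def)
qed

section \<open>The hypergraph for the upper bound\<close>

definition wES_edges :: "nat \<Rightarrow> nat set set" where
  "wES_edges m = {e. e \<subseteq> {0..m\<^sup>2} \<and> card e = Suc m \<and> (0 \<in> e \<longrightarrow> 1 \<in> e)}"

text \<open>The pigeonhole argument runs on one vertex fewer than would force a long monotone
  sequence. A counterexample makes it tight, and vertex 0 then refutes the tight case.\<close>

lemma wES_edges_consistent:
  assumes m: "m \<ge> 1" and s: "linear_order_on {0..m\<^sup>2} s"
  shows "\<exists>e\<in>wES_edges m. monotonically_consistent (nat_order_on {0..m\<^sup>2}) s e"
proof (rule ccontr)
  let ?V = "{0..m\<^sup>2}"
  define W where "W = {1..m\<^sup>2}"
  assume none: "\<not> ?thesis"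
  have W: "finite W" "W \<subseteq> ?V" "0 \<notin> W" by (simp_all add: W_def)
  have one: "1 \<in> W" using m by (auto simp: W_def)
  \<comment> \<open>Letting \<open>t\<close> be \<open>s\<close> or its converse treats increasing
    and decreasing sequences together.\<close>
  have lin: "linear_order_on ?V t" if "t \<in> {s, s\<inverse>}" for t
    using s that by auto
  have rf: "(x, x) \<in> t" if "t \<in> {s, s\<inverse>}" "x \<in> ?V" for t x
    using lin[OF that(1)] that(2) by (auto simp: order_on_defs refl_on_def)
  have tr: "trans t" if "t \<in> {s, s\<inverse>}" for t
    using lin[OF that] by (auto simp: order_on_defs)
  have no_chain: False
    if t: "t \<in> {s, s\<inverse>}" and e: "e \<in> wES_edges m" "e \<subseteq> A" and A: "A \<in> chains_from ?V t i" for t e A i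
  proof -
    have "monotonically_consistent (nat_order_on ?V) t e"
      by (rule chain_consistent[OF lin[OF t] e(2)]) (use A in \<open>auto simp: chains_from_def\<close>)
    then have "monotonically_consistent (nat_order_on ?V) s e"
      using t monotonically_consistent_converse by auto
    then show False using none e(1) by blast
  qed
  have bound: "chain_length W t i \<in> {1..m}" if t: "t \<in> {s, s\<inverse>}" and i: "i \<in> W" for t i
  proof -
    have ii: "(i, i) \<in> t" using rf t i W by blast
    obtain A where A: "A \<in> chains_from W t i" "card A = chain_length W t i"
      using longest_chain_from[OF W(1) i ii] .
    have "card A \<le> m"
    proof (rule ccontr)
      assume "\<not> card A \<le> m"
      then obtain e where e: "e \<subseteq> A" "card e = Suc m"
        using obtain_subset_with_card_n[of "Suc m" A] by (metis not_less_eq_eq)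
      \<comment> \<open>As \<open>e\<close> lies in \<open>W\<close>, it avoids 0 and the condition
        on 0 and 1 is vacuous.\<close>
      have "e \<in> wES_edges m"
        using e A(1) W by (auto simp: wES_edges_def chains_from_def)
      moreover have "A \<in> chains_from ?V t i"
        using A(1) W(2) by (auto simp: chains_from_def)
      ultimately show False using no_chain[OF t _ e(1)] by blast
    qed
    moreover have "chain_length W t i \<ge> 1"
      using card_le_chain_length[OF W(1) singleton_in_chains_from[where s = t, OF i ii]] by simp
    ultimately show ?thesis using A(2) by simp
  qed
  have tot: "\<exists>t\<in>{s, s\<inverse>}. (i, j) \<in> t" if "i \<in> ?V" "j \<in> ?V" "i < j" for i j
    using s that by (auto simp: order_on_defs total_on_def)
  have len: "chain_length W t j < chain_length W t i"
    if "t \<in> {s, s\<inverse>}" "i \<in> W" "j \<in> W" "i < j" "(i, j) \<in> t" for t i j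
    using chain_length_less[OF W(1) that(2-5) tr] rf W(2) that(1) by blast
  define lab where "lab i = (chain_length W s i, chain_length W (s\<inverse>) i)" for i
  have lab_neq: "lab i \<noteq> lab j" if ij: "i \<in> W" "j \<in> W" "i < j" for i j
  proof -
    obtain t where t: "t \<in> {s, s\<inverse>}" "(i, j) \<in> t"
      using tot ij W(2) by (meson subsetD)
    then show ?thesis using len[OF t(1) ij t(2)] by (auto simp: lab_def)
  qed
  have "inj_on lab W"
    by (rule linorder_inj_onI) (use lab_neq in auto)
  \<comment> \<open>\<open>W\<close> has exactly as many vertices as there are possible labels, so
    the injective labelling is onto.\<close>
  then have "card (lab ` W) = card ({1..m} \<times> {1..m})"
    by (simp add: card_image W_def power2_eq_square)
  moreover have "lab ` W \<subseteq> {1..m} \<times> {1..m}"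
    using bound by (auto simp: lab_def)
  ultimately have "lab ` W = {1..m} \<times> {1..m}"
    by (intro card_subset_eq) auto
  then obtain i where i: "i \<in> W" "lab i = (m, m)"
    using m by (metis (no_types, lifting) SigmaI atLeastAtMost_iff imageE order_refl)
  have full: "chain_length W t i = m" if "t \<in> {s, s\<inverse>}" for t
    using i(2) that by (auto simp: lab_def)
  \<comment> \<open>Otherwise 1 precedes \<open>i\<close> in one of the two directions and prolongs
    a chain of length \<open>m\<close> there, against \<open>bound\<close>.\<close>
  have "i = 1"
  proof (rule ccontr)
    assume "i \<noteq> 1"
    then have "1 < i" using i by (auto simp: W_def)
    then obtain t where t: "t \<in> {s, s\<inverse>}" "(1, i) \<in> t"
      using tot one i(1) W(2) by (meson subsetD)
    then have "m < chain_length W t 1"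
      using len[OF t(1) one i(1) \<open>1 < i\<close>] full by simp
    then show False using bound[OF t(1) one] by simp
  qed
  \<comment> \<open>The direction is dictated by how 0 and 1 compare. Either is fine, because both
    label entries at 1 equal \<open>m\<close>.\<close>
  obtain t where t: "t \<in> {s, s\<inverse>}" "(0, 1) \<in> t"
    using tot[OF _ subsetD[OF W(2) one] zero_less_one] by (meson atLeastAtMost_iff le0)
  obtain A where A: "A \<in> chains_from W t 1" "card A = m"
    using longest_chain_from[OF W(1) one rf[OF t(1) subsetD[OF W(2) one]]] full[OF t(1)] \<open>i = 1\<close>
    by metis
  have "insert 0 A \<in> chains_from (insert 0 W) t 0"
    using insert_in_chains_from[OF A(1) zero_less_one rf t(2) tr] t(1) by simp
  moreover have "insert 0 W = ?V" by (auto simp: W_def)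
  ultimately have chain: "insert 0 A \<in> chains_from ?V t 0" by simp
  have "0 \<notin> A" "finite A" "1 \<in> A"
    using A(1) W by (auto simp: chains_from_def intro: finite_subset)
  \<comment> \<open>The prolonged chain is an edge because \<open>A\<close> starts at 1.\<close>
  then have "insert 0 A \<in> wES_edges m"
    using A(2) chain by (auto simp: wES_edges_def chains_from_def)
  then show False using no_chain[OF t(1) _ order_refl chain] by blast
qed

text \<open>The omitted sets are 0 together with \<open>m\<close> elements of
  \<open>{2..m\<^sup>2}\<close>. The additive form avoids truncated subtraction.\<close>

lemma card_wES_edges:
  assumes m: "m \<ge> 1"
  shows "card (wES_edges m) + ((m\<^sup>2 - 1) choose m) = (m\<^sup>2 + 1) choose Suc m"
proof -
  let ?all = "{e. e \<subseteq> {0..m\<^sup>2} \<and> card e = Suc m}"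
  let ?R = "{B. B \<subseteq> {2..m\<^sup>2} \<and> card B = m}"
  have fin: "finite ?all" by (rule finite_subset[of _ "Pow {0..m\<^sup>2}"]) auto
  have mem: "insert 0 B \<in> ?all - wES_edges m" if B: "B \<in> ?R" for B
  proof -
    have "finite B" "0 \<notin> B" using B by (auto intro: finite_subset)
    then show ?thesis using B by (auto simp: wES_edges_def)
  qed
  have "?all - wES_edges m \<subseteq> insert 0 ` ?R"
  proof
    fix e assume e: "e \<in> ?all - wES_edges m"
    then have e': "e \<subseteq> {0..m\<^sup>2}" "card e = Suc m" "0 \<in> e" "1 \<notin> e"
      by (auto simp: wES_edges_def)
    have "x \<ge> 2" if "x \<in> e" "x \<noteq> 0" for x
      using that e'(4) by (cases "x = 1") auto
    then have "e - {0} \<subseteq> {2..m\<^sup>2}" using e'(1) by fastforce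
    moreover have "card (e - {0}) = m" using e' by simp
    moreover have "e = insert 0 (e - {0})" using e'(3) by blast
    ultimately show "e \<in> insert 0 ` ?R" by blast
  qed
  then have "?all - wES_edges m = insert 0 ` ?R" using mem by blast
  moreover have "inj_on (insert 0) ?R"
  proof (rule inj_onI)
    fix B B' assume B: "B \<in> ?R" "B' \<in> ?R" "insert 0 B = insert 0 B'"
    then have "0 \<notin> B" "0 \<notin> B'" by auto
    then show "B = B'" using B(3) by (simp add: insert_ident)
  qed
  ultimately have "card (?all - wES_edges m) = (m\<^sup>2 - 1) choose m"
    by (simp add: card_image n_subsets)
  moreover have "card ?all = (m\<^sup>2 + 1) choose Suc m"
    by (simp add: n_subsets del: binomial_Suc_Suc)
  moreover have "wES_edges m \<subseteq> ?all" by (auto simp: wES_edges_def)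
  then have "card (?all - wES_edges m) + card (wES_edges m) = card ?all"
    using fin by (simp add: card_Diff_subset finite_subset card_mono)
  ultimately show ?thesis by simp
qed

theorem theorem1p8:
  fixes k :: nat
  assumes "k \<ge> 3"
  shows "fact k / 2 + 1 \<le> real (f_wES k) \<and>
         real (f_wES k) \<le> real (((k - 1)\<^sup>2 + 1) choose k) - real (((k - 1)\<^sup>2 - 1) choose (k - 1))"
proof
  define m where "m = k - 1"
  have m: "m \<ge> 1" "k = Suc m" using assms by (auto simp: m_def)
  have kg: "kgraph k {0..m\<^sup>2} (wES_edges m)"
    by (auto simp: kgraph_def wES_edges_def m)
  have wES: "weak_ES {0..m\<^sup>2} (wES_edges m)"
    unfolding weak_ES_def using linear_order_on_nat_order_on wES_edges_consistent[OF m(1)] by blast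
  have "f_wES k \<le> card (wES_edges m)"
    using kg wES by (rule f_wES_le)
  then show "real (f_wES k)
      \<le> real (((k - 1)\<^sup>2 + 1) choose k) - real (((k - 1)\<^sup>2 - 1) choose (k - 1))"
    using arg_cong[OF card_wES_edges[OF m(1)], of real] by (simp add: m(2) del: binomial_Suc_Suc)
  \<comment> \<open>The explicit hypergraph ensures that the minimum is attained.\<close>
  have "\<exists>(V :: nat set) E. kgraph k V E \<and> weak_ES V E \<and> card E = f_wES k"
    unfolding f_wES_def by (rule LeastI) (use kg wES in blast)
  then obtain V :: "nat set" and E where "kgraph k V E" "weak_ES V E" "card E = f_wES k"
    by blast
  then have "fact k < 2 * f_wES k"
    using fact_less_twice_card_edges[OF assms] by metis
  \<comment> \<open>By parity the strict inequality between \<open>fact k\<close> and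
    \<open>2 * f_wES k\<close> has a gap of at least 2, which becomes the \<open>+ 1\<close> after
    halving.\<close>
  moreover have "even (fact k :: nat)"
    using assms by (intro dvd_fact) auto
  ultimately have "fact k + 2 \<le> 2 * f_wES k"
    by presburger
  then have "real (fact k + 2) \<le> real (2 * f_wES k)"
    by (rule of_nat_mono)
  then show "fact k / 2 + 1 \<le> real (f_wES k)"
    by simp
qed

end
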